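(* The sets $B$, $AB_0$, $\widehat{AB_0}$ and $\widehat{B^2}$ partition the nonnegative integers. The sets $G(n)$, for $n>0$, partition the set $AB$.
   Context: Let $\phi=\frac{1+\sqrt5}{2}$, and for integers $n\ge 0$ let $A(n)=\lfloor n\phi\rfloor$ and $B(n)=\lfloor n\phi^2\rfloor=\lfloor n\phi\rfloor+n$ (so $A(0)=B(0)=0$). Juxtaposition and powers denote composition: $AB(n)=A(B(n))$, $B^2(n)=B(B(n))$, and $B^k$ is the $k$-fold composition of $B$. Define the sets $B=\{B(n): n\ge 1\}=\{\lfloor n\phi\rfloor+n : n\ge 1\}$, $AB_0=\{AB(n): n\ge 0\}=\{2\lfloor n\phi\rfloor+n : n\ge 0\}$, $AB=\{AB(n): n\ge 1\}$, $\widehat{AB_0}=\{AB(n)+1 : n\ge 0\}=\{2\lfloor n\phi\rfloor+n+1 : n\ge 0\}$, $\widehat{B^2}=\{B^2(n)+1 : n\ge 1\}=\{3\lfloor n\phi\rfloor+2n+1 : n\ge 1\}$. The Fibonacci numbers are $F_{-1}=1$, $F_0=0$, $F_1=F_2=1$, and $F_n=F_{n-1}+F_{n-2}$ for $n\ge 3$. For all integers $i\ge 0$ and $n\ge 0$ let $$G_i(n)=\lfloor i\phi\rfloor F_{2n+2}+iF_{2n+1}+F_{2n+3}-2=B^{n+1}(i)+F_{2n+3}-2,$$ and for all $n>0$ let $G(n)=\{G_i(n) : i>0\}$.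
   Formalization: The sets G(n) are taken as {G_i(n) : i ≥ 0} instead of i > 0, because with i > 0 the claim fails: 3 = AB(1) lies in AB but in no G(n) with n > 0, since the smallest such element is G_1(1) = 8. *)

theory Defs
  imports Complex_Main "HOL-Library.Disjoint_Sets" "HOL-Number_Theory.Fib"
begin

definition \<phi> :: real
  where "\<phi> = (1 + sqrt 5) / 2"

definition A :: "nat \<Rightarrow> nat"
  where "A n = nat \<lfloor>real n * \<phi>\<rfloor>"

definition B :: "nat \<Rightarrow> nat"
  where "B n = nat \<lfloor>real n * \<phi>\<^sup>2\<rfloor>"

definition set_B :: "nat set"
  where "set_B = {B n | n. n \<ge> 1}"

definition set_AB0 :: "nat set"
  where "set_AB0 = {A (B n) | n. n \<ge> 0}"

definition set_AB :: "nat set"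
  where "set_AB = {A (B n) | n. n \<ge> 1}"

definition set_AB0_hat :: "nat set"
  where "set_AB0_hat = {A (B n) + 1 | n. n \<ge> 0}"

definition set_BB_hat :: "nat set"
  where "set_BB_hat = {B (B n) + 1 | n. n \<ge> 1}"

text \<open>The subtraction on \<open>nat\<close> never truncates, since \<open>fib (2 * n + 3) \<ge> 2\<close>.\<close>

definition G :: "nat \<Rightarrow> nat \<Rightarrow> nat"
  where "G i n = A i * fib (2 * n + 2) + i * fib (2 * n + 1) + fib (2 * n + 3) - 2"

text \<open>
  The index \<open>i = 0\<close> has to be included: the numbers \<open>G 0 n = fib (2 * n + 3) - 2\<close> for
  \<open>n > 0\<close>, i.e. 3, 11, 32, ..., belong to \<open>set_AB\<close> (for instance \<open>3 = A (B 1)\<close>) and are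
  not of the form \<open>G i m\<close> with \<open>i > 0\<close> and \<open>m > 0\<close>. With \<open>i > 0\<close> the sets \<open>set_G n\<close>
  would therefore not cover \<open>set_AB\<close>.
\<close>

definition set_G :: "nat \<Rightarrow> nat set"
  where "set_G n = {G i n | i. i \<ge> 0}"

lemma phi_square: "\<phi>\<^sup>2 = \<phi> + 1"
  by (simp add: \<phi>_def power2_eq_square field_simps)

lemma phi_gt_1: "1 < \<phi>"
  using real_less_rsqrt[of 1 5] by (simp add: \<phi>_def)

lemma phi_lt_2: "\<phi> < 2"
  using real_less_lsqrt[of 3 5] by (simp add: \<phi>_def)

lemma B_eq: "B n = A n + n"
proof -
  have "real n * \<phi>\<^sup>2 = real n * \<phi> + of_int (int n)"
    by (simp add: phi_square algebra_simps)
  then have "\<lfloor>real n * \<phi>\<^sup>2\<rfloor> = \<lfloor>real n * \<phi>\<rfloor> + int n"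
    by (simp only: floor_add_int)
  moreover have "0 \<le> \<lfloor>real n * \<phi>\<rfloor>"
    using phi_gt_1 by simp
  ultimately show ?thesis
    by (simp add: A_def B_def nat_add_distrib)
qed

lemma A_eqI:
  assumes "real m \<le> real n * \<phi>" "real n * \<phi> < real m + 1"
  shows "A n = m"
proof -
  have "\<lfloor>real n * \<phi>\<rfloor> = int m"
    using assms by (intro floor_unique) auto
  then show ?thesis by (simp add: A_def)
qed

lemma A_bounds: "real (A n) \<le> real n * \<phi>" "real n * \<phi> < real (A n) + 1"
proof -
  have "0 \<le> \<lfloor>real n * \<phi>\<rfloor>"
    using phi_gt_1 by simp
  then have "real (A n) = of_int \<lfloor>real n * \<phi>\<rfloor>"
    by (simp add: A_def)
  then show "real (A n) \<le> real n * \<phi>" "real n * \<phi> < real (A n) + 1"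
    by linarith+
qed

lemma fib_phi_bounds:
  "0 < real (fib (2 * n + 1)) - (\<phi> - 1) * real (fib (2 * n + 2)) \<and>
   real (fib (2 * n + 1)) - (\<phi> - 1) * real (fib (2 * n + 2)) \<le> 1"
proof (induction n)
  case 0
  then show ?case using phi_gt_1 phi_lt_2 by (simp add: numeral_2_eq_2)
next
  case (Suc n)
  define c where "c = real (fib (2 * n + 1)) - (\<phi> - 1) * real (fib (2 * n + 2))"
  have f: "fib (2 * Suc n + 1) = fib (2 * n + 1) + fib (2 * n + 2)"
          "fib (2 * Suc n + 2) = fib (2 * n + 1) + 2 * fib (2 * n + 2)"
    by (simp_all add: numeral_2_eq_2)
  have p: "\<phi> * (\<phi> * x) = \<phi> * x + x" for x
    using phi_square by (simp add: power2_eq_square algebra_simps flip: mult.assoc)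
  have "real (fib (2 * Suc n + 1)) - (\<phi> - 1) * real (fib (2 * Suc n + 2)) = (2 - \<phi>) * c"
    unfolding f c_def by (simp add: algebra_simps p)
  moreover have "0 < (2 - \<phi>) * c" "(2 - \<phi>) * c \<le> 1"
    using Suc phi_gt_1 phi_lt_2 mult_le_one[of "2 - \<phi>" c] by (auto simp: c_def)
  ultimately show ?case by simp
qed

lemma B_funpow: "(B ^^ (n + 1)) i = A i * fib (2 * n + 2) + i * fib (2 * n + 1)"
proof (induction n)
  case 0
  then show ?case by (simp add: B_eq numeral_2_eq_2)
next
  case (Suc n)
  define m where "m = A i * fib (2 * n + 2) + i * fib (2 * n + 1)"
  define l where "l = A i * (fib (2 * n + 1) + fib (2 * n + 2)) + i * fib (2 * n + 2)"
  define c where "c = real (fib (2 * n + 1)) - (\<phi> - 1) * real (fib (2 * n + 2))"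
  define e where "e = real i * \<phi> - real (A i)"
  have p: "\<phi> * (\<phi> * x) = \<phi> * x + x" for x
    using phi_square by (simp add: power2_eq_square algebra_simps flip: mult.assoc)
  have eq: "real m * \<phi> = real l + e * c"
    by (simp add: m_def l_def c_def e_def algebra_simps p)
  have e: "0 \<le> e" "e < 1"
    using A_bounds[of i] by (auto simp: e_def)
  have c: "0 < c" "c \<le> 1"
    using fib_phi_bounds[of n] by (auto simp: c_def)
  have "0 \<le> e * c" "e * c < 1"
    using e c mult_left_le[of c e] by auto
  then have "A m = l"
    using eq by (intro A_eqI) auto
  moreover have "(B ^^ (Suc n + 1)) i = B m"
    using Suc by (simp only: m_def add_Suc funpow.simps comp_apply)
  ultimately have "(B ^^ (Suc n + 1)) i = l + m"
    by (simp only: B_eq[of m])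
  also have "\<dots> = A i * fib (2 * Suc n + 2) + i * fib (2 * Suc n + 1)"
    by (simp add: m_def l_def algebra_simps numeral_2_eq_2)
  finally show ?case .
qed

lemma G_eq: "G i n = (B ^^ (n + 1)) i + fib (2 * n + 3) - 2"
  by (simp only: G_def B_funpow)

end

theory Submission
  imports Defs
begin

text \<open>
  By Wythoff's theorem every natural number is either \<open>A n\<close> with \<open>n \<ge> 0\<close> or \<open>B n\<close> with \<open>n \<ge> 1\<close>,
  in exactly one way. Applying this dichotomy to the argument of \<open>A\<close> splits the range of \<open>A\<close> into
  \<open>AB\<^sub>0\<close> and \<open>{A (A k) | k \<ge> 1}\<close>. Applying it to \<open>k - 1\<close> splits the latter, by
  \<open>A (A (A q + 1)) = A (B q) + 1\<close> and \<open>A (A (B q + 1)) = B (B q) + 1\<close>.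

  Likewise, every \<open>m \<ge> 1\<close> is either \<open>A j + 1\<close> or \<open>h i\<close> with \<open>i \<ge> 1\<close>, where \<open>h i = B i + 1 > i\<close>.
  Iterating, \<open>m = h\<^sup>k (A j + 1)\<close> for unique \<open>k\<close> and \<open>j\<close>, and
  \<open>A (B (h\<^sup>k (A j + 1))) = G j (k + 1)\<close>.
\<close>

section \<open>Arithmetic of the golden ratio\<close>

lemma phi_phi: "\<phi> * (\<phi> * x) = \<phi> * x + x"
  using phi_square by (simp add: power2_eq_square algebra_simps flip: mult.assoc)

text \<open>Irrationality of \<open>\<phi>\<close> by descent: \<open>n * \<phi> = m\<close> implies \<open>(m - n) * \<phi> = n\<close>.\<close>

lemma phi_multiple_not_nat:
  assumes "real n * \<phi> = real m"
  shows "n = 0"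
  using assms
proof (induction n arbitrary: m rule: less_induct)
  case (less n)
  show ?case
  proof (rule ccontr)
    assume "n \<noteq> 0"
    then have n: "0 < real n" by simp
    \<comment> \<open>\<open>1 < \<phi> < 2\<close> makes the smaller multiplier
      \<open>m - n\<close> positive and less than \<open>n\<close>.\<close>
    have "real n * 1 < real n * \<phi>" "real n * \<phi> < real n * 2"
      using n phi_gt_1 phi_lt_2 by (simp_all only: mult_less_cancel_left_pos)
    then have m: "n < m" "m < 2 * n"
      using less.prems by linarith+
    have "real (m - n) * \<phi> = \<phi> * (\<phi> * real n) - real n * \<phi>"
      using m less.prems by (simp add: algebra_simps)
    also have "\<dots> = real n"
      by (simp add: phi_phi algebra_simps)
    finally have "m - n = 0"
      using m by (intro less.IH[of "m - n" n]) auto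
    with m show False by simp
  qed
qed

section \<open>Floor identities for compositions of \<open>A\<close> and \<open>B\<close>\<close>

lemma A_0 [simp]: "A 0 = 0" and B_0 [simp]: "B 0 = 0"
  by (simp_all add: A_def B_def)

lemma A_less_Suc: "A n < A (Suc n)"
proof -
  have "real (A n) + 1 < real (A (Suc n)) + 1"
    using A_bounds(1)[of n] A_bounds(2)[of "Suc n"] phi_gt_1
    by (simp add: algebra_simps)
  then show ?thesis by simp
qed

lemma strict_mono_A: "strict_mono A"
  by (simp add: strict_mono_Suc_iff A_less_Suc)

lemma strict_mono_B: "strict_mono B"
  using A_less_Suc by (simp add: strict_mono_Suc_iff B_eq less_SucI)

lemma A_eq_iff [simp]: "A m = A n \<longleftrightarrow> m = n" and B_eq_iff [simp]: "B m = B n \<longleftrightarrow> m = n"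
  using strict_mono_A strict_mono_B by (simp_all add: strict_mono_eq)

text \<open>Write e for the fractional part of n \<phi>. Substituting n \<phi> = \<open>A n\<close>
  + e into \<phi> (n \<phi>) = n \<phi> + n leaves an integer and a small multiple of e, so the
  floors below can be read off.\<close>

lemma A_A_times_phi:
  "real (A n) * \<phi> = real (B n) - (real n * \<phi> - real (A n)) * (\<phi> - 1)"
  using phi_phi[of "real n"] by (simp add: B_eq algebra_simps)

lemma A_B_times_phi:
  "real (B n) * \<phi> = real (A n + B n) + (real n * \<phi> - real (A n)) * (2 - \<phi>)"
  using phi_phi[of "real n"] by (simp add: B_eq algebra_simps)

lemma frac_times:
  assumes "0 < c"
  shows "0 \<le> (real n * \<phi> - real (A n)) * c" "(real n * \<phi> - real (A n)) * c < c"
proof -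
  have "0 \<le> real n * \<phi> - real (A n)" "real n * \<phi> - real (A n) < 1"
    using A_bounds[of n] by auto
  then show "0 \<le> (real n * \<phi> - real (A n)) * c" "(real n * \<phi> - real (A n)) * c < c"
    using assms mult_strict_right_mono[of "real n * \<phi> - real (A n)" 1 c] by auto
qed

lemma A_A:
  assumes "n \<ge> 1"
  shows "A (A n) + 1 = B n"
proof -
  \<comment> \<open>Irrationality makes the fractional part strictly positive, so
    \<open>A n * \<phi>\<close> falls just short of \<open>B n\<close>.\<close>
  have "real n * \<phi> \<noteq> real (A n)"
    using phi_multiple_not_nat[of n "A n"] assms by auto
  then have "0 < real n * \<phi> - real (A n)"
    using A_bounds(1)[of n] by simp
  then have "0 < (real n * \<phi> - real (A n)) * (\<phi> - 1)"
    using phi_gt_1 by simp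
  moreover have "1 \<le> B n"
    using assms by (simp add: B_eq)
  moreover have "(real n * \<phi> - real (A n)) * (\<phi> - 1) < \<phi> - 1"
    by (rule frac_times) (use phi_gt_1 in simp)
  moreover note A_A_times_phi[of n] phi_lt_2 of_nat_diff[of 1 "B n", where ?'a = real]
  ultimately have "A (A n) = B n - 1"
    by (intro A_eqI) linarith+
  with \<open>1 \<le> B n\<close> show ?thesis by simp
qed

lemma A_B: "A (B n) = A n + B n"
proof (rule A_eqI)
  have "(real n * \<phi> - real (A n)) * (2 - \<phi>) < 2 - \<phi>"
       "0 \<le> (real n * \<phi> - real (A n)) * (2 - \<phi>)"
    using frac_times[of "2 - \<phi>" n] phi_lt_2 by auto
  then show "real (A n + B n) \<le> real (B n) * \<phi>" "real (B n) * \<phi> < real (A n + B n) + 1"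
    using A_B_times_phi[of n] phi_gt_1 by linarith+
qed

text \<open>The deficit below \<open>B n\<close> is less than \<open>\<phi> - 1\<close>, so adding
  \<phi> lands strictly above \<open>B n + 1\<close> and below \<open>B n + 2\<close>.\<close>

lemma A_Suc_A: "A (Suc (A n)) = Suc (B n)"
proof (rule A_eqI)
  have "(real n * \<phi> - real (A n)) * (\<phi> - 1) < \<phi> - 1"
       "0 \<le> (real n * \<phi> - real (A n)) * (\<phi> - 1)"
    using frac_times[of "\<phi> - 1" n] phi_gt_1 by auto
  moreover have "real (Suc (A n)) * \<phi> = real (A n) * \<phi> + \<phi>"
    by (simp add: algebra_simps)
  ultimately show "real (Suc (B n)) \<le> real (Suc (A n)) * \<phi>"
      "real (Suc (A n)) * \<phi> < real (Suc (B n)) + 1"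
    using A_A_times_phi[of n] phi_lt_2 by simp_all
qed

text \<open>The excess over \<open>A (B n)\<close> is less than \<open>2 - \<phi>\<close>, so adding
  \<phi> keeps the total excess between 1 and 2.\<close>

lemma A_Suc_B: "A (Suc (B n)) = Suc (A (B n))"
proof (rule A_eqI)
  have "(real n * \<phi> - real (A n)) * (2 - \<phi>) < 2 - \<phi>"
       "0 \<le> (real n * \<phi> - real (A n)) * (2 - \<phi>)"
    using frac_times[of "2 - \<phi>" n] phi_lt_2 by auto
  moreover have "real (Suc (B n)) * \<phi> = real (B n) * \<phi> + \<phi>"
    by (simp add: algebra_simps)
  ultimately show "real (Suc (A (B n))) \<le> real (Suc (B n)) * \<phi>"
      "real (Suc (B n)) * \<phi> < real (Suc (A (B n))) + 1"
    using A_B_times_phi[of n] phi_gt_1 unfolding A_B by linarith+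
qed

section \<open>Wythoff's theorem\<close>

lemma A_neq_B:
  assumes "n \<ge> 1"
  shows "A m \<noteq> B n"
proof
  assume "A m = B n"
  \<comment> \<open>\<open>B n\<close> lies strictly between the consecutive values
    \<open>A (A n) = B n - 1\<close> and \<open>A (Suc (A n)) = B n + 1\<close>.\<close>
  then have "A (A n) < A m" "A m < A (Suc (A n))"
    using A_A[OF assms] by (simp_all add: A_Suc_A)
  then show False
    using strict_mono_A by (simp add: strict_mono_less)
qed

text \<open>If \<open>A\<close> misses \<open>k\<close>, then \<open>k\<close> lies in the gap after
  the last value \<open>A n\<close> below it. By induction \<open>n\<close> is \<open>A m\<close> or
  \<open>B m\<close>: after \<open>A (B m)\<close> there is no gap, and after \<open>A (A m)\<close>
  the only missing number is \<open>B m\<close>.\<close>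

lemma A_or_B:
  obtains (A) n where "k = A n" | (B) n where "n \<ge> 1" "k = B n"
proof -
  have "(\<exists>n. k = A n) \<or> (\<exists>n\<ge>1. k = B n)"
  proof (induction k rule: less_induct)
    case (less k)
    define n where "n = (GREATEST n. A n \<le> k)"
    have bound: "\<And>n. A n \<le> k \<Longrightarrow> n \<le> k"
      using strict_mono_imp_increasing[OF strict_mono_A] le_trans by blast
    have n: "A n \<le> k"
      unfolding n_def by (rule GreatestI_nat[of _ 0 k]) (use bound in auto)
    have Suc_n: "k < A (Suc n)"
    proof (rule ccontr)
      assume "\<not> k < A (Suc n)"
      then have "Suc n \<le> n"
        unfolding n_def by (intro Greatest_le_nat[of _ _ k]) (use bound in auto)
      then show False by simp
    qed
    show ?case
    proof (cases "A n = k")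
      case False
      with n have "A n < k" by simp
      moreover have "n \<le> A n"
        by (rule strict_mono_imp_increasing[OF strict_mono_A])
      ultimately have "n < k" by simp
      from less.IH[OF this] have "(\<exists>m. n = A m) \<or> (\<exists>m. n = B m)" by blast
      then consider m where "n = A m" | m where "n = B m" by blast
      then show ?thesis
      proof cases
        case (1 m)
        \<comment> \<open>For \<open>m = 0\<close> the gap would be between \<open>A 0 = 0\<close>
          and \<open>A 1 = 1\<close>, which is empty.\<close>
        have "m \<noteq> 0"
          using 1 \<open>A n < k\<close> Suc_n A_Suc_A[of 0] by (cases "m = 0") auto
        then have "A n + 1 = B m"
          using A_A[of m] 1 by simp
        moreover have "k < B m + 1"
          using Suc_n 1 by (simp add: A_Suc_A)
        ultimately have "k = B m"
          using \<open>A n < k\<close> by simp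
        with \<open>m \<noteq> 0\<close> show ?thesis by (intro disjI2 exI[of _ m]) simp
      next
        case (2 m)
        then show ?thesis
          using \<open>A n < k\<close> Suc_n by (simp add: A_Suc_B)
      qed
    qed auto
  qed
  then show ?thesis using that by blast
qed

section \<open>The partition into four sets\<close>

lemma A_A_Suc_A: "A (A (Suc (A q))) = A (B q) + 1"
  by (simp add: A_Suc_A A_Suc_B)

lemma A_A_Suc_B: "A (A (Suc (B q))) = B (B q) + 1"
  by (simp add: A_Suc_A A_Suc_B)

text \<open>With both hatted sets written as values of \<open>A\<close>, injectivity of
  \<open>A\<close> reduces disjointness to comparing values of \<open>A\<close> and
  \<open>B\<close>.\<close>

lemma set_AB0_hat_eq: "set_AB0_hat = {A (A (Suc (A q))) | q. q \<ge> 0}"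
  unfolding set_AB0_hat_def A_A_Suc_A ..

lemma set_BB_hat_eq: "set_BB_hat = {A (A (Suc (B q))) | q. q \<ge> 1}"
  unfolding set_BB_hat_def A_A_Suc_B ..

text \<open>Covers \<open>n = 0\<close> too, as \<open>A (Suc m)\<close> is positive;
  \<open>set_AB0\<close> includes that index.\<close>

lemma A_Suc_neq_B: "A (Suc m) \<noteq> B n"
  using A_neq_B[of n "Suc m"] A_eq_iff[of "Suc m" 0]
  by (cases "n = 0") (auto simp del: A_eq_iff)

lemma four_sets_cover: "set_B \<union> set_AB0 \<union> set_AB0_hat \<union> set_BB_hat = UNIV"
proof (rule UNIV_eq_I[symmetric])
  fix k
  show "k \<in> set_B \<union> set_AB0 \<union> set_AB0_hat \<union> set_BB_hat"
  proof (cases k rule: A_or_B)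
    case (B n)
    then show ?thesis by (auto simp: set_B_def)
  next
    case (A m)
    show ?thesis
    proof (cases m rule: A_or_B)
      case (B n)
      with A show ?thesis by (auto simp: set_AB0_def)
    next
      case A': (A n)
      show ?thesis
      proof (cases n)
        case 0
        then show ?thesis using A A' by (auto simp: set_AB0_def intro: exI[of _ 0])
      next
        case (Suc p)
        show ?thesis
          unfolding A A' Suc
          by (cases p rule: A_or_B) (auto simp: set_AB0_hat_eq set_BB_hat_eq)
      qed
    qed
  qed
qed

lemma four_sets_disjoint:
  "set_B \<inter> set_AB0 = {}" "set_B \<inter> set_AB0_hat = {}" "set_B \<inter> set_BB_hat = {}"
  "set_AB0 \<inter> set_AB0_hat = {}" "set_AB0 \<inter> set_BB_hat = {}" "set_AB0_hat \<inter> set_BB_hat = {}"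
proof -
  show "set_B \<inter> set_AB0 = {}"
    using A_neq_B by (fastforce simp: set_B_def set_AB0_def)
  show "set_B \<inter> set_AB0_hat = {}"
    using A_neq_B by (fastforce simp: set_B_def set_AB0_hat_eq)
  show "set_B \<inter> set_BB_hat = {}"
    using A_neq_B by (fastforce simp: set_B_def set_BB_hat_eq)
  show "set_AB0 \<inter> set_AB0_hat = {}"
    using A_Suc_neq_B[symmetric] by (auto simp: set_AB0_def set_AB0_hat_eq)
  show "set_AB0 \<inter> set_BB_hat = {}"
    using A_Suc_neq_B[symmetric] by (auto simp: set_AB0_def set_BB_hat_eq)
  show "set_AB0_hat \<inter> set_BB_hat = {}"
    using A_neq_B by (auto simp: set_AB0_hat_eq set_BB_hat_eq)
qed

lemma four_sets_nonempty: "set_B \<noteq> {}" "set_AB0 \<noteq> {}" "set_AB0_hat \<noteq> {}" "set_BB_hat \<noteq> {}"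
  by (auto simp: set_B_def set_AB0_def set_AB0_hat_def set_BB_hat_def)

section \<open>Iterates of \<open>h\<close> and the partition of AB\<close>

definition h :: "nat \<Rightarrow> nat"
  where "h m = Suc (B m)"

lemma inj_h: "inj h"
  by (simp add: inj_def h_def)

lemma funpow_h_Suc: "(h ^^ Suc k) m = Suc (B ((h ^^ k) m))"
  by (simp add: h_def[of "(h ^^ k) m"])

lemma funpow_h_closed_forms:
  defines "m j k \<equiv> (h ^^ k) (Suc (A j))"
  shows "m j k = A j * fib (2 * k + 1) + j * fib (2 * k) + fib (2 * k + 2)"
    and "A (m j k) + 1 = A j * fib (2 * k + 2) + j * fib (2 * k + 1) + fib (2 * k + 3)"
proof -
  have "m j k = A j * fib (2 * k + 1) + j * fib (2 * k) + fib (2 * k + 2) \<and>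
    A (m j k) + 1 = A j * fib (2 * k + 2) + j * fib (2 * k + 1) + fib (2 * k + 3)"
  proof (induction k)
    case 0
    then show ?case
      by (simp add: m_def A_Suc_A B_eq eval_nat_numeral)
  next
    case (Suc k)
    have "m j (Suc k) = A (m j k) + 1 + m j k"
      by (simp add: m_def funpow_h_Suc B_eq del: funpow.simps(2))
    moreover have "A (m j (Suc k)) = A (m j k) + (A (m j k) + 1) + m j k"
      unfolding m_def funpow_h_Suc A_Suc_B A_B by (simp add: B_eq)
    \<comment> \<open>In terms of x = \<open>m j k\<close> and y = \<open>A (m j k) + 1\<close> the
      recursion is (x, y) -> (x + y, x + 2 y), a double Fibonacci step; the shift by 1 makes it
      homogeneous.\<close>
    ultimately have step: "m j (Suc k) = (A (m j k) + 1) + m j k"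
      "A (m j (Suc k)) + 1 = 2 * (A (m j k) + 1) + m j k"
      by simp_all
    have IH: "m j k = A j * fib (2 * k + 1) + j * fib (2 * k) + fib (2 * k + 2)"
      "A (m j k) + 1 = A j * fib (2 * k + 2) + j * fib (2 * k + 1) + fib (2 * k + 3)"
      using Suc.IH by (rule conjunct1, rule conjunct2)
    show ?case
    proof
      show "m j (Suc k) = A j * fib (2 * Suc k + 1) + j * fib (2 * Suc k) + fib (2 * Suc k + 2)"
        \<comment> \<open>\<open>IH(2)\<close> goes first: \<open>IH(1)\<close> would rewrite the
          argument of \<open>A\<close>.\<close>
        unfolding step(1) IH(2) unfolding IH(1) by (simp add: eval_nat_numeral algebra_simps)
      show "A (m j (Suc k)) + 1 =
          A j * fib (2 * Suc k + 2) + j * fib (2 * Suc k + 1) + fib (2 * Suc k + 3)"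
        unfolding step(2) IH(2) unfolding IH(1) by (simp add: eval_nat_numeral algebra_simps)
    qed
  qed
  then show "m j k = A j * fib (2 * k + 1) + j * fib (2 * k) + fib (2 * k + 2)"
    "A (m j k) + 1 = A j * fib (2 * k + 2) + j * fib (2 * k + 1) + fib (2 * k + 3)" by auto
qed

text \<open>\<open>A (B m) = 2 * A m + m\<close> is the next y of the Fibonacci recursion minus 2,
  which explains the 2 subtracted in \<open>G\<close>.\<close>

lemma A_B_funpow_h: "A (B ((h ^^ k) (Suc (A j)))) = G j (Suc k)"
proof -
  define m where "m = (h ^^ k) (Suc (A j))"
  have "A (B m) = 2 * (A m + 1) + m - 2"
    unfolding A_B by (simp add: B_eq)
  also have "\<dots> = 2 * (A j * fib (2 * k + 2) + j * fib (2 * k + 1) + fib (2 * k + 3)) +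
      (A j * fib (2 * k + 1) + j * fib (2 * k) + fib (2 * k + 2)) - 2"
    by (simp only: m_def funpow_h_closed_forms(2)) (simp only: funpow_h_closed_forms(1))
  also have "\<dots> = G j (Suc k)"
    by (simp add: G_def eval_nat_numeral algebra_simps)
  finally show ?thesis by (simp add: m_def)
qed

lemma funpow_h_pos: "0 < (h ^^ k) (Suc (A j))"
  by (cases k) (simp_all add: h_def)

lemma funpow_h_exists:
  assumes "m \<ge> 1"
  shows "\<exists>k j. m = (h ^^ k) (Suc (A j))"
  using assms
proof (induction m rule: less_induct)
  case (less m)
  then obtain p where p: "m = Suc p" by (cases m) auto
  show ?case
  proof (cases p rule: A_or_B)
    case (A j)
    with p show ?thesis by (intro exI[of _ 0] exI[of _ j]) simp
  next
    case (B i)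
    with p have "i < m" by (simp add: B_eq)
    with less.IH B obtain k j where "i = (h ^^ k) (Suc (A j))" by blast
    with p B show ?thesis by (intro exI[of _ "Suc k"] exI[of _ j]) (simp only: funpow_h_Suc)
  qed
qed

text \<open>Cancelling common applications of \<open>h\<close> ends, if the levels differ, with a
  value of \<open>A\<close> equal to \<open>B\<close> at a positive argument.\<close>

lemma funpow_h_level_unique:
  "(h ^^ k) (Suc (A i)) = (h ^^ l) (Suc (A j)) \<Longrightarrow> k = l"
proof (induction k arbitrary: l)
  case 0
  show ?case
  proof (cases l)
    case (Suc l')
    with 0 have "A i = B ((h ^^ l') (Suc (A j)))"
      by (simp add: funpow_h_Suc del: funpow.simps(2))
    with A_neq_B funpow_h_pos[of l' j] show ?thesis by auto
  qed simp
next
  case (Suc k)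
  show ?case
  proof (cases l)
    case 0
    with Suc.prems have "A j = B ((h ^^ k) (Suc (A i)))"
      by (simp add: funpow_h_Suc del: funpow.simps(2))
    with A_neq_B funpow_h_pos[of k i] show ?thesis by auto
  next
    case (Suc l')
    with Suc.prems Suc.IH[of l'] show ?thesis by (simp add: inj_eq[OF inj_h])
  qed
qed

lemma set_G_disjoint:
  assumes "x \<in> set_G m" "x \<in> set_G n" "m > 0" "n > 0"
  shows "m = n"
proof -
  obtain i j where ij: "G i m = G j n"
    using assms by (auto simp: set_G_def)
  obtain k l where kl: "m = Suc k" "n = Suc l"
    using assms by (meson gr0_implies_Suc)
  then have "(h ^^ k) (Suc (A i)) = (h ^^ l) (Suc (A j))"
    using ij by (simp flip: A_B_funpow_h)
  then show ?thesis
    using funpow_h_level_unique kl by blast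
qed

lemma set_G_cover: "\<Union> (set_G ` {n. n > 0}) = set_AB"
proof (intro equalityI subsetI)
  fix x
  assume "x \<in> \<Union> (set_G ` {n. n > 0})"
  then obtain n j where "n > 0" "x = G j n" by (auto simp: set_G_def)
  then obtain k where "x = A (B ((h ^^ k) (Suc (A j))))"
    by (metis A_B_funpow_h gr0_implies_Suc)
  then show "x \<in> set_AB"
    using funpow_h_pos[of k j] by (auto simp: set_AB_def Suc_le_eq)
next
  fix x
  assume "x \<in> set_AB"
  then obtain m where m: "m \<ge> 1" "x = A (B m)" by (auto simp: set_AB_def)
  then obtain k j where "m = (h ^^ k) (Suc (A j))" using funpow_h_exists by blast
  with m have "x = G j (Suc k)" by (simp add: A_B_funpow_h)
  then show "x \<in> \<Union> (set_G ` {n. n > 0})" by (auto simp: set_G_def)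
qed

text \<open>\<open>distinct\<close> and \<open>inj_on\<close> are stated because
  \<open>partition_on\<close> takes a set of blocks, where repeated blocks would merge
  unnoticed.\<close>

theorem lemma2p1:
  shows "(distinct [set_B, set_AB0, set_AB0_hat, set_BB_hat] \<and>
          partition_on (UNIV :: nat set) {set_B, set_AB0, set_AB0_hat, set_BB_hat}) \<and>
         (inj_on set_G {n. n > 0} \<and>
          partition_on set_AB (set_G ` {n. n > 0}))"
proof (intro conjI)
  show "distinct [set_B, set_AB0, set_AB0_hat, set_BB_hat]"
    using four_sets_disjoint four_sets_nonempty
    by (metis distinct_length_2_or_more distinct_singleton inf.idem)
  show "partition_on UNIV {set_B, set_AB0, set_AB0_hat, set_BB_hat}"
  proof (rule partition_onI)
    show "\<Union> {set_B, set_AB0, set_AB0_hat, set_BB_hat} = UNIV"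
      using four_sets_cover by (simp add: Un_assoc)
  next
    fix p q
    assume "p \<in> {set_B, set_AB0, set_AB0_hat, set_BB_hat}"
      "q \<in> {set_B, set_AB0, set_AB0_hat, set_BB_hat}" "p \<noteq> q"
    then show "disjnt p q"
      using four_sets_disjoint by (auto simp: disjnt_def Int_commute)
  qed (use four_sets_nonempty in auto)
  have nonempty: "G 0 n \<in> set_G n" for n
    by (auto simp: set_G_def)
  show "inj_on set_G {n. n > 0}"
  proof (rule inj_onI)
    fix m n :: nat
    assume "m \<in> {n. n > 0}" "n \<in> {n. n > 0}" "set_G m = set_G n"
    \<comment> \<open>Equal sets share the element \<open>G 0 m\<close>, so disjointness forces
      equal indices.\<close>
    with nonempty[of m] show "m = n"
      by (intro set_G_disjoint[of "G 0 m"]) auto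
  qed
  show "partition_on set_AB (set_G ` {n. n > 0})"
  proof (rule partition_onI[OF set_G_cover])
    fix p q
    assume "p \<in> set_G ` {n. n > 0}" "q \<in> set_G ` {n. n > 0}" "p \<noteq> q"
    then show "disjnt p q"
      using set_G_disjoint by (auto simp: disjnt_iff)
  qed (use nonempty in auto)
qed

end
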